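(* Let $(X,\sigma)$ be a DR system on a metric space $(X,d)$, let $\Omega$ be its nonwandering set, $\mathfrak{W}$ its wandering set, and $\overline{\mathfrak{W}}$ the closure of $\mathfrak{W}$ in $X$. Let $(\Omega,\sigma_{|_\Omega})$ and $(\overline{\mathfrak{W}},\sigma_{|_{\overline{\mathfrak{W}}}})$ be the restricted DR systems. Then $$h_d(\sigma)=\max\{h_d(\sigma_{|_\Omega}),\,h_d(\sigma_{|_{\overline{\mathfrak{W}}}})\}.$$
   Context: A DR (Deaconu-Renault) system $(X,\sigma)$ consists of a locally compact Hausdorff space $X$ and a local homeomorphism $\sigma:\operatorname{Dom}(\sigma)\to\operatorname{Im}(\sigma)$ from an open set $\operatorname{Dom}(\sigma)\subseteq X$ onto an open set $\operatorname{Im}(\sigma)\subseteq X$. Iterates $\sigma^n$ are compositions of the partially defined map $\sigma$ on their natural domains $\operatorname{Dom}(\sigma^n)$, with $\sigma^0=\mathrm{id}$ and $\operatorname{Dom}(\sigma^0)=X$. $\mathbb{N}=\{1,2,\dots\}$. For any $Y\subseteq X$ and $n\ge 0$, $\sigma^n(Y)$ means $\sigma^n(Y\cap\operatorname{Dom}(\sigma^n))$; for $k<0$, $\sigma^k(Y)=\{x\in\operatorname{Dom}(\sigma^{-k}):\sigma^{-k}(x)\in Y\}$. A point $x\in X$ is wandering if there is an open neighborhood $U$ of $x$ with $\sigma^n(U)\cap\sigma^{-k}(\sigma^k(U))=\emptyset$ for all $n\ge1$ and all $k\in\mathbb{Z}$; otherwise $x$ is nonwandering. $\mathfrak{W}$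 and $\Omega$ denote the sets of wandering and nonwandering points. For $Y\subseteq X$ with $\sigma(\operatorname{Dom}(\sigma)\cap Y)$ an open subset of $Y$ (induced topology), the restricted DR system $(Y,\sigma_{|_Y})$ is given by the restriction of $\sigma$ to $Y$, with $\operatorname{Dom}(\sigma_{|_Y})=\operatorname{Dom}(\sigma)\cap Y$ and $\operatorname{Im}(\sigma_{|_Y})=\sigma(\operatorname{Dom}(\sigma)\cap Y)$. (The sets $\Omega$ and $\overline{\mathfrak{W}}$ satisfy this.) Its entropy is computed by the definitions below applied to $(Y,\sigma_{|_Y})$ with the metric $d$ restricted to $Y$ (compact sets $K\subseteq Y$, closed sets $F$ relative to $Y$). Entropy: let $d$ be a metric inducing the topology of $X$. For $x\in X$, $n\in\mathbb{N}$, let $I_n(x)=\{i\in\{0,\dots,n-1\}:x\in\operatorname{Dom}(\sigma^i)\}$ and $d_n(x,y)=\max_{i\in I_n(x)\cap I_n(y)}d(\sigma^i(x),\sigma^i(y))$. For $K\subseteq X$ compact, $Y\subseteq X$ and $\varepsilon>0$, a set $A\subseteq K\cap Y$ is $(n,\varepsilon,\sigma,K\cap Y)$-separated if $d_n(x,y)>\varepsilon$ for all distinct $x,y\in A$; $\mathrm{sep}(n,\varepsilon,\sigma,K\cap Y)$ is the largest cardinality of such a set. Put $\mathrm{ssep}(n,\varepsilon,\sigma,K)=\sup_F\mathrm{sep}(n,\varepsilon,\sigma,K\cap F)$, the supremum over all closed sets $F\subseteq X$ with $F\subseteq\operatorname{Dom}(\sigma^{n-1})$. Then $h_\varepsilon(\sigma,K,d)=\limsup_{n\to\infty}\frac1n\log\mathrm{ssep}(n,\varepsilon,\sigma,K)$,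 $h_d(\sigma,K)=\lim_{\varepsilon\to0}h_\varepsilon(\sigma,K,d)$, and $h_d(\sigma)=\sup_K h_d(\sigma,K)$ over all compact $K\subseteq X$. Values are extended real numbers, with $\log 0=-\infty$ and $\log\infty=\infty$. *)

theory Defs
  imports "HOL-Analysis.Analysis"
begin

text \<open>
  A DR system is given by a space \<open>X\<close>, the set \<open>D = Dom(\<sigma>)\<close> and a total function \<open>\<sigma>\<close> of which
  only the values on \<open>D\<close> matter; \<open>Im(\<sigma>)\<close> is \<open>\<sigma> ` D\<close>.
\<close>

definition DR_system :: "'a topology \<Rightarrow> 'a set \<Rightarrow> ('a \<Rightarrow> 'a) \<Rightarrow> bool" where
  "DR_system X D \<sigma> \<longleftrightarrow>
     locally_compact_space X \<and> Hausdorff_space X \<and>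
     openin X D \<and> openin X (\<sigma> ` D) \<and>
     (\<forall>x\<in>D. \<exists>U. openin X U \<and> x \<in> U \<and> U \<subseteq> D \<and> openin X (\<sigma> ` U) \<and>
        homeomorphic_map (subtopology X U) (subtopology X (\<sigma> ` U)) \<sigma>)"

text \<open>\<open>iter_dom X D \<sigma> n\<close> is \<open>Dom(\<sigma>\<^sup>n)\<close>; on it the iterate is \<open>\<sigma> ^^ n\<close>.\<close>

primrec iter_dom :: "'a topology \<Rightarrow> 'a set \<Rightarrow> ('a \<Rightarrow> 'a) \<Rightarrow> nat \<Rightarrow> 'a set" where
  "iter_dom X D \<sigma> 0 = topspace X"
| "iter_dom X D \<sigma> (Suc n) = {x \<in> iter_dom X D \<sigma> n. (\<sigma> ^^ n) x \<in> D}"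

text \<open>\<open>\<sigma>\<^sup>k(Y)\<close> for an integer \<open>k\<close>: a forward image if \<open>k \<ge> 0\<close>, a preimage if \<open>k < 0\<close>.\<close>

definition iter_set :: "'a topology \<Rightarrow> 'a set \<Rightarrow> ('a \<Rightarrow> 'a) \<Rightarrow> int \<Rightarrow> 'a set \<Rightarrow> 'a set" where
  "iter_set X D \<sigma> k Y =
     (if k \<ge> 0 then (\<sigma> ^^ nat k) ` (Y \<inter> iter_dom X D \<sigma> (nat k))
      else {x \<in> iter_dom X D \<sigma> (nat (- k)). (\<sigma> ^^ nat (- k)) x \<in> Y})"

definition wandering :: "'a topology \<Rightarrow> 'a set \<Rightarrow> ('a \<Rightarrow> 'a) \<Rightarrow> 'a \<Rightarrow> bool" where
  "wandering X D \<sigma> x \<longleftrightarrow>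
     (\<exists>U. openin X U \<and> x \<in> U \<and>
        (\<forall>n::nat. \<forall>k::int. n \<ge> 1 \<longrightarrow>
           iter_set X D \<sigma> (int n) U \<inter> iter_set X D \<sigma> (- k) (iter_set X D \<sigma> k U) = {}))"

definition wandering_set :: "'a topology \<Rightarrow> 'a set \<Rightarrow> ('a \<Rightarrow> 'a) \<Rightarrow> 'a set" where
  "wandering_set X D \<sigma> = {x \<in> topspace X. wandering X D \<sigma> x}"

definition nonwandering_set :: "'a topology \<Rightarrow> 'a set \<Rightarrow> ('a \<Rightarrow> 'a) \<Rightarrow> 'a set" where
  "nonwandering_set X D \<sigma> = {x \<in> topspace X. \<not> wandering X D \<sigma> x}"

definition iter_idx :: "'a topology \<Rightarrow> 'a set \<Rightarrow> ('a \<Rightarrow> 'a) \<Rightarrow> nat \<Rightarrow> 'a \<Rightarrow> nat set" where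
  "iter_idx X D \<sigma> n x = {i. i < n \<and> x \<in> iter_dom X D \<sigma> i}"

text \<open>
  The distance \<open>d\<^sub>n\<close>. For \<open>n \<ge> 1\<close> and \<open>x, y\<close> in \<open>X\<close> the maximum is over a finite set containing
  the index 0.
\<close>

definition iter_dist ::
  "'a topology \<Rightarrow> 'a set \<Rightarrow> ('a \<Rightarrow> 'a) \<Rightarrow> ('a \<Rightarrow> 'a \<Rightarrow> real) \<Rightarrow> nat \<Rightarrow> 'a \<Rightarrow> 'a \<Rightarrow> real" where
  "iter_dist X D \<sigma> d n x y =
     Max ((\<lambda>i. d ((\<sigma> ^^ i) x) ((\<sigma> ^^ i) y)) ` (iter_idx X D \<sigma> n x \<inter> iter_idx X D \<sigma> n y))"

definition separated_set ::
  "'a topology \<Rightarrow> 'a set \<Rightarrow> ('a \<Rightarrow> 'a) \<Rightarrow> ('a \<Rightarrow> 'a \<Rightarrow> real) \<Rightarrow> nat \<Rightarrow> real \<Rightarrow> 'a set \<Rightarrow> 'a set \<Rightarrow> bool"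
  where
  "separated_set X D \<sigma> d n \<epsilon> S A \<longleftrightarrow>
     A \<subseteq> S \<and> (\<forall>x\<in>A. \<forall>y\<in>A. x \<noteq> y \<longrightarrow> iter_dist X D \<sigma> d n x y > \<epsilon>)"

definition ext_card :: "'a set \<Rightarrow> ereal" where
  "ext_card A = (if finite A then ereal (real (card A)) else \<infinity>)"

definition sep ::
  "'a topology \<Rightarrow> 'a set \<Rightarrow> ('a \<Rightarrow> 'a) \<Rightarrow> ('a \<Rightarrow> 'a \<Rightarrow> real) \<Rightarrow> nat \<Rightarrow> real \<Rightarrow> 'a set \<Rightarrow> ereal" where
  "sep X D \<sigma> d n \<epsilon> S = (SUP A\<in>{A. separated_set X D \<sigma> d n \<epsilon> S A}. ext_card A)"

definition ssep ::
  "'a topology \<Rightarrow> 'a set \<Rightarrow> ('a \<Rightarrow> 'a) \<Rightarrow> ('a \<Rightarrow> 'a \<Rightarrow> real) \<Rightarrow> nat \<Rightarrow> real \<Rightarrow> 'a set \<Rightarrow> ereal" where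
  "ssep X D \<sigma> d n \<epsilon> K =
     (SUP F\<in>{F. closedin X F \<and> F \<subseteq> iter_dom X D \<sigma> (n - 1)}. sep X D \<sigma> d n \<epsilon> (K \<inter> F))"

definition ext_ln :: "ereal \<Rightarrow> ereal" where
  "ext_ln a = (if a = \<infinity> then \<infinity> else if a \<le> 0 then - \<infinity> else ereal (ln (real_of_ereal a)))"

definition entropy_eps ::
  "'a topology \<Rightarrow> 'a set \<Rightarrow> ('a \<Rightarrow> 'a) \<Rightarrow> ('a \<Rightarrow> 'a \<Rightarrow> real) \<Rightarrow> real \<Rightarrow> 'a set \<Rightarrow> ereal" where
  "entropy_eps X D \<sigma> d \<epsilon> K =
     limsup (\<lambda>n. ereal (1 / real n) * ext_ln (ssep X D \<sigma> d n \<epsilon> K))"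

text \<open>The limit always exists in the extended reals, by monotonicity in \<open>\<epsilon>\<close>.\<close>

definition entropy_on ::
  "'a topology \<Rightarrow> 'a set \<Rightarrow> ('a \<Rightarrow> 'a) \<Rightarrow> ('a \<Rightarrow> 'a \<Rightarrow> real) \<Rightarrow> 'a set \<Rightarrow> ereal" where
  "entropy_on X D \<sigma> d K = Lim (at_right 0) (\<lambda>\<epsilon>. entropy_eps X D \<sigma> d \<epsilon> K)"

definition DR_entropy ::
  "'a topology \<Rightarrow> 'a set \<Rightarrow> ('a \<Rightarrow> 'a) \<Rightarrow> ('a \<Rightarrow> 'a \<Rightarrow> real) \<Rightarrow> ereal" where
  "DR_entropy X D \<sigma> d = (SUP K\<in>{K. compactin X K}. entropy_on X D \<sigma> d K)"

text \<open>
  Entropy of the restricted system on \<open>Y\<close>: the space is \<open>Y\<close> with the induced topology, the domain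
  is \<open>D \<inter> Y\<close>, and all iterates, compact sets and closed sets are those of this system.
\<close>

definition restricted_entropy ::
  "'a topology \<Rightarrow> 'a set \<Rightarrow> ('a \<Rightarrow> 'a) \<Rightarrow> ('a \<Rightarrow> 'a \<Rightarrow> real) \<Rightarrow> 'a set \<Rightarrow> ereal" where
  "restricted_entropy X D \<sigma> d Y = DR_entropy (subtopology X Y) (D \<inter> Y) \<sigma> d"

end

theory Submission
  imports Defs
begin

text \<open>
  The nonwandering set \<open>\<Omega>\<close> and the closure of the wandering set are closed sets that cover \<open>X\<close>, and
  \<open>\<sigma>\<close> maps each of them into itself. The entropy formula holds for any two sets with these properties
  (\<open>DR_entropy_closed_cover\<close>), for two reasons.

  If \<open>Y\<close> is closed and forward invariant, restricting to \<open>Y\<close> changes nothing on \<open>Y\<close>: orbits that start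
  in \<open>Y\<close> stay there, so a point of \<open>Y\<close> has the same iterates in both systems, and the closed subsets
  of \<open>Y\<close> are the closed subsets of \<open>X\<close> that lie in \<open>Y\<close>. Hence a compact \<open>K \<subseteq> Y\<close> has the same entropy
  in both systems, and the entropy of the restriction is the supremum of \<open>h\<^sub>d(\<sigma>, K)\<close> over these \<open>K\<close>
  (\<open>restricted_entropy_eq_SUP\<close>). In particular it is at most \<open>h\<^sub>d(\<sigma>)\<close>.

  Conversely, a compact \<open>K\<close> is the union of its compact parts in the two sets. A separated subset of
  \<open>K \<union> L\<close> splits into a separated subset of \<open>K\<close> and one of \<open>L\<close>, so the separation numbers are
  subadditive; a sum is at most twice the larger term, and the factor 2 disappears in the exponential
  growth rate. Hence \<open>h\<^sub>d(\<sigma>, K \<union> L)\<close> is at most the larger of the two entropies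
  (\<open>entropy_on_Un_le\<close>).

  The invariance of \<open>\<Omega>\<close> and of the closure of the wandering set rests on one fact: for \<open>x\<close> in the
  domain, \<open>x\<close> is wandering if and only if \<open>\<sigma>(x)\<close> is (\<open>wandering_apply_iff\<close>). The reason is that an open
  set witnesses wandering exactly if \<open>\<sigma>\<^sup>m(u) \<noteq> \<sigma>\<^sup>k(v)\<close> for all its points \<open>u\<close>, \<open>v\<close> and all \<open>m > k\<close>, and
  this condition passes to images and to preimages under the continuous open map \<open>\<sigma>\<close>.
\<close>

section \<open>Iterates of a local homeomorphism\<close>

locale Deaconu_Renault =
  fixes X :: "'a topology" and D :: "'a set" and \<sigma> :: "'a \<Rightarrow> 'a"
  assumes DR: "DR_system X D \<sigma>"
begin

lemma domain_subset: "D \<subseteq> topspace X"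
  using DR openin_subset unfolding DR_system_def by blast

lemma range_subset: "\<sigma> ` D \<subseteq> topspace X"
  using DR openin_subset unfolding DR_system_def by metis

lemma openin_preimage:
  assumes "openin X V"
  shows "openin X {x \<in> D. \<sigma> x \<in> V}"
proof (subst openin_subopen, safe)
  fix x assume x: "x \<in> D" "\<sigma> x \<in> V"
  obtain U where U: "openin X U" "x \<in> U" "U \<subseteq> D"
    and hom: "homeomorphic_map (subtopology X U) (subtopology X (\<sigma> ` U)) \<sigma>"
    using DR x(1) unfolding DR_system_def by blast
  have "continuous_map (subtopology X U) X \<sigma>"
    using hom homeomorphic_imp_continuous_map continuous_map_into_fulltopology by blast
  then have "openin (subtopology X U) {y \<in> topspace (subtopology X U). \<sigma> y \<in> V}"
    using assms openin_continuous_map_preimage by blast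
  moreover have "{y \<in> topspace (subtopology X U). \<sigma> y \<in> V} = {y \<in> U. \<sigma> y \<in> V}"
    using openin_subset[OF U(1)] by auto
  ultimately have "openin (subtopology X U) {y \<in> U. \<sigma> y \<in> V}"
    by simp
  then have "openin X {y \<in> U. \<sigma> y \<in> V}"
    using U(1) by (auto simp: openin_open_subtopology)
  then show "\<exists>T. openin X T \<and> x \<in> T \<and> T \<subseteq> {x \<in> D. \<sigma> x \<in> V}"
    using U x by blast
qed

lemma openin_image:
  assumes "openin X V"
  shows "openin X (\<sigma> ` (V \<inter> D))"
proof (subst openin_subopen, safe)
  fix x assume x: "x \<in> V" "x \<in> D"
  obtain U where U: "openin X U" "x \<in> U" "U \<subseteq> D" "openin X (\<sigma> ` U)"
    and hom: "homeomorphic_map (subtopology X U) (subtopology X (\<sigma> ` U)) \<sigma>"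
    using DR x(2) unfolding DR_system_def by blast
  have "openin (subtopology X U) (V \<inter> U)"
    using assms by (simp add: openin_subtopology_Int)
  then have "openin (subtopology X (\<sigma> ` U)) (\<sigma> ` (V \<inter> U))"
    using hom homeomorphic_imp_open_map open_map_def by metis
  then have "openin X (\<sigma> ` (V \<inter> U))"
    using U(4) by (simp add: openin_open_subtopology)
  then show "\<exists>T. openin X T \<and> \<sigma> x \<in> T \<and> T \<subseteq> \<sigma> ` (V \<inter> D)"
    using U x by blast
qed

lemma iter_dom_add:
  "iter_dom X D \<sigma> (n + k) = {x \<in> iter_dom X D \<sigma> n. (\<sigma> ^^ n) x \<in> iter_dom X D \<sigma> k}"
proof (induction k)
  case 0
  have "(\<sigma> ^^ n) x \<in> topspace X" if "x \<in> iter_dom X D \<sigma> n" for x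
    using that range_subset by (cases n) auto
  then show ?case by auto
next
  case (Suc k)
  have "(\<sigma> ^^ (n + k)) x = (\<sigma> ^^ k) ((\<sigma> ^^ n) x)" for x
    by (metis add.commute comp_apply funpow_add)
  with Suc show ?case by auto
qed

lemma iter_dom_Suc_iff: "x \<in> iter_dom X D \<sigma> (Suc n) \<longleftrightarrow> x \<in> D \<and> \<sigma> x \<in> iter_dom X D \<sigma> n"
  using iter_dom_add[of 1 n] domain_subset by auto

section \<open>Wandering points\<close>

text \<open>
  In groupoid terms: no arrow of the Deaconu--Renault groupoid with nonzero degree \<open>m - k\<close> has both its
  source and its range in \<open>U\<close>. It suffices to exclude positive degrees, as \<open>u\<close> and \<open>v\<close> can be swapped.
\<close>

definition wandering_nbhd :: "'a set \<Rightarrow> bool" where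
  "wandering_nbhd U \<longleftrightarrow>
     (\<forall>u\<in>U. \<forall>v\<in>U. \<forall>m k. k < m \<longrightarrow> u \<in> iter_dom X D \<sigma> m \<longrightarrow> v \<in> iter_dom X D \<sigma> k \<longrightarrow>
        (\<sigma> ^^ m) u \<noteq> (\<sigma> ^^ k) v)"

lemma wandering_nbhdD:
  assumes "wandering_nbhd U" "u \<in> U" "v \<in> U" "k < m"
    and "u \<in> iter_dom X D \<sigma> m" "v \<in> iter_dom X D \<sigma> k"
  shows "(\<sigma> ^^ m) u \<noteq> (\<sigma> ^^ k) v"
  using assms unfolding wandering_nbhd_def by blast

text \<open>
  For \<open>k \<ge> 0\<close>, a point \<open>\<sigma>\<^sup>n(u)\<close> lies in \<open>\<sigma>\<^sup>-\<^sup>k(\<sigma>\<^sup>k(U))\<close> exactly if \<open>\<sigma>\<^sup>n\<^sup>+\<^sup>k(u) = \<sigma>\<^sup>k(v)\<close> for some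
  \<open>v \<in> U\<close>, so the substitution \<open>m = n + k\<close> turns one condition into the other.
\<close>

lemma disjoint_iterates_iff_wandering_nbhd:
  assumes "U \<subseteq> topspace X"
  shows "(\<forall>n::nat. \<forall>k::int. n \<ge> 1 \<longrightarrow>
            iter_set X D \<sigma> (int n) U \<inter> iter_set X D \<sigma> (- k) (iter_set X D \<sigma> k U) = {})
         \<longleftrightarrow> wandering_nbhd U" (is "?L \<longleftrightarrow> _")
proof
  assume L: ?L
  show "wandering_nbhd U"
    unfolding wandering_nbhd_def
  proof (intro ballI allI impI notI)
    fix u v m k
    assume uv: "u \<in> U" "v \<in> U" and km: "(k::nat) < m"
      and dom: "u \<in> iter_dom X D \<sigma> m" "v \<in> iter_dom X D \<sigma> k" and eq: "(\<sigma> ^^ m) u = (\<sigma> ^^ k) v"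
    define n where "n = m - k"
    have m: "m = n + k" and n: "n \<ge> 1" using km by (auto simp: n_def)
    let ?y = "(\<sigma> ^^ n) u"
    have u: "u \<in> iter_dom X D \<sigma> n" and y: "?y \<in> iter_dom X D \<sigma> k"
      using dom(1) unfolding m iter_dom_add by auto
    have yk: "(\<sigma> ^^ k) ?y = (\<sigma> ^^ k) v"
      using eq m by (metis add.commute comp_apply funpow_add)
    have 1: "?y \<in> iter_set X D \<sigma> (int n) U"
      using u uv by (auto simp: iter_set_def)
    have 2: "?y \<in> iter_set X D \<sigma> (- int k) (iter_set X D \<sigma> (int k) U)"
    proof (cases "k = 0")
      case True
      have "v \<in> topspace X" using assms uv by blast
      with True yk uv show ?thesis by (auto simp: iter_set_def)
    next
      case False
      then show ?thesis using y yk uv dom(2) by (auto simp: iter_set_def)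
    qed
    from L n have "iter_set X D \<sigma> (int n) U \<inter> iter_set X D \<sigma> (- int k) (iter_set X D \<sigma> (int k) U) = {}"
      by blast
    with 1 2 show False by blast
  qed
next
  assume W: "wandering_nbhd U"
  show ?L
  proof (intro allI impI equals0I)
    fix n :: nat and k :: int and y
    assume n: "n \<ge> 1"
      and "y \<in> iter_set X D \<sigma> (int n) U \<inter> iter_set X D \<sigma> (- k) (iter_set X D \<sigma> k U)"
    then obtain u where u: "u \<in> U" "u \<in> iter_dom X D \<sigma> n" and yu: "y = (\<sigma> ^^ n) u"
      and y: "y \<in> iter_set X D \<sigma> (- k) (iter_set X D \<sigma> k U)"
      by (auto simp: iter_set_def)
    show False
    proof (cases "k > 0")
      case True
      define j where "j = nat k"
      from y True obtain v where v: "v \<in> U" "v \<in> iter_dom X D \<sigma> j" "(\<sigma> ^^ j) y = (\<sigma> ^^ j) v"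
        and yj: "y \<in> iter_dom X D \<sigma> j"
        by (auto simp: iter_set_def j_def)
      have "u \<in> iter_dom X D \<sigma> (n + j)"
        using u yu yj by (simp add: iter_dom_add)
      moreover have "(\<sigma> ^^ (n + j)) u = (\<sigma> ^^ j) v"
        using v(3) yu by (metis add.commute comp_apply funpow_add)
      ultimately show False
        using wandering_nbhdD[OF W u(1) v(1), of j "n + j"] v(2) n by simp
    next
      case False
      \<comment> \<open>For \<open>k \<le> 0\<close> the set \<open>\<sigma>\<^sup>-\<^sup>k(\<sigma>\<^sup>k(U))\<close> lies in \<open>U\<close>, so these cases reduce to \<open>k = 0\<close>.\<close>
      then have "y \<in> U"
        using y by (cases "k = 0") (auto simp: iter_set_def)
      then show False
        using wandering_nbhdD[OF W u(1) _, of y 0 n] u n assms yu by auto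
    qed
  qed
qed

lemma wandering_iff:
  "wandering X D \<sigma> x \<longleftrightarrow> (\<exists>U. openin X U \<and> x \<in> U \<and> wandering_nbhd U)"
  unfolding wandering_def
  by (intro ex_cong1 conj_cong refl disjoint_iterates_iff_wandering_nbhd openin_subset)

lemma openin_wandering_set: "openin X (wandering_set X D \<sigma>)"
proof (subst openin_subopen, safe)
  fix x assume "x \<in> wandering_set X D \<sigma>"
  then obtain U where U: "openin X U" "x \<in> U" "wandering_nbhd U"
    by (auto simp: wandering_set_def wandering_iff)
  then have "U \<subseteq> wandering_set X D \<sigma>"
    unfolding wandering_set_def wandering_iff using openin_subset by blast
  then show "\<exists>T. openin X T \<and> x \<in> T \<and> T \<subseteq> wandering_set X D \<sigma>" using U by blast
qed

lemma nonwandering_set_eq: "nonwandering_set X D \<sigma> = topspace X - wandering_set X D \<sigma>"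
  by (auto simp: nonwandering_set_def wandering_set_def)

lemma closedin_nonwandering_set: "closedin X (nonwandering_set X D \<sigma>)"
  unfolding nonwandering_set_eq using openin_wandering_set by blast

text \<open>
  A coincidence \<open>\<sigma>\<^sup>m(u) = \<sigma>\<^sup>k(v)\<close> upstairs gives \<open>\<sigma>\<^sup>m\<^sup>-\<^sup>1(\<sigma>(u)) = \<sigma>\<^sup>k\<^sup>-\<^sup>1(\<sigma>(v))\<close> downstairs.
\<close>

lemma wandering_nbhd_preimage:
  assumes U: "wandering_nbhd U"
  shows "wandering_nbhd {x \<in> D. \<sigma> x \<in> U}"
  unfolding wandering_nbhd_def
proof (intro ballI allI impI notI)
  fix u v m k
  assume uv: "u \<in> {x \<in> D. \<sigma> x \<in> U}" "v \<in> {x \<in> D. \<sigma> x \<in> U}" and km: "(k::nat) < m"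
    and dom: "u \<in> iter_dom X D \<sigma> m" "v \<in> iter_dom X D \<sigma> k" and eq: "(\<sigma> ^^ m) u = (\<sigma> ^^ k) v"
  show False
  proof (cases k)
    case 0
    \<comment> \<open>Here \<open>v = \<sigma>\<^sup>m(u)\<close> lies in \<open>D\<close>, so \<open>\<sigma>\<close> can be applied once more to both sides.\<close>
    have v: "v = (\<sigma> ^^ m) u" using eq 0 by simp
    then have "u \<in> iter_dom X D \<sigma> (Suc m)" using uv dom by simp
    then have "\<sigma> u \<in> iter_dom X D \<sigma> m" by (simp add: iter_dom_Suc_iff del: iter_dom.simps)
    moreover have "\<sigma> v \<in> iter_dom X D \<sigma> 0" using uv range_subset by auto
    moreover have "(\<sigma> ^^ m) (\<sigma> u) = (\<sigma> ^^ 0) (\<sigma> v)" using v by (simp add: funpow_swap1)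
    ultimately show False using wandering_nbhdD[OF U, of "\<sigma> u" "\<sigma> v" 0 m] uv km by auto
  next
    case (Suc k')
    obtain m' where m: "m = Suc m'" using km by (cases m) auto
    have "\<sigma> u \<in> iter_dom X D \<sigma> m'" "\<sigma> v \<in> iter_dom X D \<sigma> k'"
      using dom unfolding m Suc iter_dom_Suc_iff by auto
    moreover have "(\<sigma> ^^ m') (\<sigma> u) = (\<sigma> ^^ k') (\<sigma> v)"
      using eq unfolding m Suc by (simp add: funpow_swap1)
    ultimately show False using wandering_nbhdD[OF U, of "\<sigma> u" "\<sigma> v" k' m'] uv km m Suc by auto
  qed
qed

lemma wandering_nbhd_image:
  assumes U: "wandering_nbhd U"
  shows "wandering_nbhd (\<sigma> ` (U \<inter> D))"
  unfolding wandering_nbhd_def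
proof (intro ballI allI impI notI)
  fix u' v' m k
  assume uv': "u' \<in> \<sigma> ` (U \<inter> D)" "v' \<in> \<sigma> ` (U \<inter> D)" and km: "(k::nat) < m"
    and dom: "u' \<in> iter_dom X D \<sigma> m" "v' \<in> iter_dom X D \<sigma> k" and eq: "(\<sigma> ^^ m) u' = (\<sigma> ^^ k) v'"
  obtain u v where uv: "u \<in> U \<inter> D" "v \<in> U \<inter> D" "u' = \<sigma> u" "v' = \<sigma> v" using uv' by auto
  have "u \<in> iter_dom X D \<sigma> (Suc m)" "v \<in> iter_dom X D \<sigma> (Suc k)"
    using uv dom by (auto simp: iter_dom_Suc_iff simp del: iter_dom.simps)
  moreover have "(\<sigma> ^^ Suc m) u = (\<sigma> ^^ Suc k) v" using eq uv by (simp add: funpow_swap1)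
  ultimately show False using wandering_nbhdD[OF U, of u v "Suc k" "Suc m"] uv km by auto
qed

lemma wandering_apply_iff:
  assumes "x \<in> D"
  shows "wandering X D \<sigma> (\<sigma> x) \<longleftrightarrow> wandering X D \<sigma> x"
proof
  assume "wandering X D \<sigma> (\<sigma> x)"
  then obtain U where "openin X U" "\<sigma> x \<in> U" "wandering_nbhd U"
    by (auto simp: wandering_iff)
  with assms openin_preimage wandering_nbhd_preimage show "wandering X D \<sigma> x"
    unfolding wandering_iff by blast
next
  assume "wandering X D \<sigma> x"
  then obtain U where "openin X U" "x \<in> U" "wandering_nbhd U"
    by (auto simp: wandering_iff)
  with assms openin_image wandering_nbhd_image show "wandering X D \<sigma> (\<sigma> x)"
    unfolding wandering_iff by blast
qed

lemma nonwandering_set_forward_invariant: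
  "\<sigma> ` (D \<inter> nonwandering_set X D \<sigma>) \<subseteq> nonwandering_set X D \<sigma>"
  using range_subset wandering_apply_iff by (auto simp: nonwandering_set_def)

text \<open>
  Continuity of \<open>\<sigma>\<close>: wandering points near \<open>x\<close> are mapped to wandering points near \<open>\<sigma>(x)\<close>.
\<close>

lemma closure_wandering_set_forward_invariant:
  "\<sigma> ` (D \<inter> X closure_of wandering_set X D \<sigma>) \<subseteq> X closure_of wandering_set X D \<sigma>"
proof clarify
  fix x assume x: "x \<in> D" "x \<in> X closure_of wandering_set X D \<sigma>"
  show "\<sigma> x \<in> X closure_of wandering_set X D \<sigma>"
    unfolding in_closure_of
  proof (intro conjI allI impI)
    show "\<sigma> x \<in> topspace X" using range_subset x by blast
    fix T assume T: "\<sigma> x \<in> T \<and> openin X T"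
    then have "openin X {y \<in> D. \<sigma> y \<in> T}" by (simp add: openin_preimage)
    moreover have "x \<in> {y \<in> D. \<sigma> y \<in> T}" using x(1) T by simp
    ultimately obtain y where "y \<in> wandering_set X D \<sigma>" "y \<in> {y \<in> D. \<sigma> y \<in> T}"
      using x(2) unfolding in_closure_of by meson
    then have y: "y \<in> D" "\<sigma> y \<in> T" "y \<in> wandering_set X D \<sigma>" by auto
    then have "\<sigma> y \<in> wandering_set X D \<sigma>"
      using range_subset by (auto simp: wandering_set_def wandering_apply_iff)
    with y show "\<exists>y. y \<in> wandering_set X D \<sigma> \<and> y \<in> T" by blast
  qed
qed

end

section \<open>Separated sets\<close>

lemma ext_card_Un_le: "ext_card (A \<union> B) \<le> ext_card A + ext_card B"
proof -
  have "real (card (A \<union> B)) \<le> real (card A) + real (card B)"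
    using card_Un_le[of A B] by linarith
  then show ?thesis by (auto simp: ext_card_def)
qed

lemma sep_upper: "separated_set X D \<sigma> d n \<epsilon> S A \<Longrightarrow> ext_card A \<le> sep X D \<sigma> d n \<epsilon> S"
  unfolding sep_def by (rule SUP_upper) simp

lemma ssep_upper:
  "closedin X F \<Longrightarrow> F \<subseteq> iter_dom X D \<sigma> (n - 1) \<Longrightarrow>
     sep X D \<sigma> d n \<epsilon> (K \<inter> F) \<le> ssep X D \<sigma> d n \<epsilon> K"
  unfolding ssep_def by (rule SUP_upper) simp

lemma ssep_nonneg: "0 \<le> ssep X D \<sigma> d n \<epsilon> K"
proof -
  have "ext_card ({} :: 'a set) \<le> sep X D \<sigma> d n \<epsilon> (K \<inter> {})"
    by (rule sep_upper) (simp add: separated_set_def)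
  also have "\<dots> \<le> ssep X D \<sigma> d n \<epsilon> K"
    by (rule ssep_upper) auto
  finally show ?thesis by (simp add: ext_card_def zero_ereal_def)
qed

lemma ssep_antimono_eps:
  assumes "\<epsilon> \<le> \<epsilon>'"
  shows "ssep X D \<sigma> d n \<epsilon>' K \<le> ssep X D \<sigma> d n \<epsilon> K"
proof -
  have "separated_set X D \<sigma> d n \<epsilon> S A" if "separated_set X D \<sigma> d n \<epsilon>' S A" for S A
    using that assms unfolding separated_set_def by (meson le_less_trans)
  then have "sep X D \<sigma> d n \<epsilon>' S \<le> sep X D \<sigma> d n \<epsilon> S" for S
    unfolding sep_def by (intro SUP_subset_mono) auto
  then show ?thesis
    unfolding ssep_def by (intro SUP_mono')
qed

text \<open>
  Both parts of a separated set are cut out with the same closed set \<open>F\<close>, so each is admissible in the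
  supremum that it is compared with.
\<close>

lemma ssep_Un_le:
  "ssep X D \<sigma> d n \<epsilon> (K \<union> L) \<le> ssep X D \<sigma> d n \<epsilon> K + ssep X D \<sigma> d n \<epsilon> L"
proof -
  have "ext_card A \<le> ssep X D \<sigma> d n \<epsilon> K + ssep X D \<sigma> d n \<epsilon> L"
    if F: "closedin X F" "F \<subseteq> iter_dom X D \<sigma> (n - 1)"
      and A: "separated_set X D \<sigma> d n \<epsilon> ((K \<union> L) \<inter> F) A" for F A
  proof -
    have *: "ext_card (A \<inter> M) \<le> ssep X D \<sigma> d n \<epsilon> M" for M
    proof -
      have "separated_set X D \<sigma> d n \<epsilon> (M \<inter> F) (A \<inter> M)"
        using A by (auto simp: separated_set_def)
      from order_trans[OF sep_upper[OF this] ssep_upper[OF F]] show ?thesis .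
    qed
    have "A = (A \<inter> K) \<union> (A \<inter> L)" using A by (auto simp: separated_set_def)
    then have "ext_card A \<le> ext_card (A \<inter> K) + ext_card (A \<inter> L)"
      using ext_card_Un_le by metis
    also have "\<dots> \<le> ssep X D \<sigma> d n \<epsilon> K + ssep X D \<sigma> d n \<epsilon> L"
      by (intro add_mono *)
    finally show ?thesis .
  qed
  then show ?thesis
    unfolding ssep_def[of X D \<sigma> d n \<epsilon> "K \<union> L"] sep_def by (auto intro!: SUP_least)
qed

section \<open>Exponential growth rates\<close>

lemma ext_ln_mono: "a \<le> b \<Longrightarrow> ext_ln a \<le> ext_ln b"
  by (cases a; cases b) (auto simp: ext_ln_def)

lemma ext_ln_add_le:
  assumes "0 \<le> a" "0 \<le> b"
  shows "ext_ln (a + b) \<le> ereal (ln 2) + max (ext_ln a) (ext_ln b)"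
proof -
  have double: "ext_ln (c + c) \<le> ereal (ln 2) + ext_ln c" if "0 \<le> c" for c
  proof (cases c)
    case (real r)
    with that show ?thesis
      by (cases "r = 0") (auto simp: ext_ln_def ln_mult simp flip: mult_2)
  qed (use that in \<open>auto simp: ext_ln_def\<close>)
  show ?thesis
  proof (cases "a \<le> b")
    case True
    then have "ext_ln (a + b) \<le> ext_ln (b + b)" by (intro ext_ln_mono add_mono) auto
    also have "\<dots> \<le> ereal (ln 2) + ext_ln b" using double assms by blast
    finally show ?thesis using ext_ln_mono[OF True] by (simp add: max_absorb2)
  next
    case False
    then have ba: "b \<le> a" by simp
    then have "ext_ln (a + b) \<le> ext_ln (a + a)" by (intro ext_ln_mono add_mono) auto
    also have "\<dots> \<le> ereal (ln 2) + ext_ln a" using double assms by blast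
    finally show ?thesis using ext_ln_mono[OF ba] by (simp add: max_absorb1)
  qed
qed

lemma limsup_max_ereal:
  fixes f g :: "nat \<Rightarrow> ereal"
  shows "limsup (\<lambda>n. max (f n) (g n)) = max (limsup f) (limsup g)"
proof (rule antisym)
  show "limsup (\<lambda>n. max (f n) (g n)) \<le> max (limsup f) (limsup g)"
    unfolding Limsup_le_iff
  proof (intro allI impI)
    fix y assume "max (limsup f) (limsup g) < y"
    then have "\<forall>\<^sub>F n in sequentially. f n < y" "\<forall>\<^sub>F n in sequentially. g n < y"
      by (auto intro: Limsup_lessD)
    then show "\<forall>\<^sub>F n in sequentially. max (f n) (g n) < y"
      by eventually_elim simp
  qed
  show "max (limsup f) (limsup g) \<le> limsup (\<lambda>n. max (f n) (g n))"
    by (auto intro!: Limsup_mono)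
qed

text \<open>
  The term \<open>ln 2\<close> lost in bounding a sum by twice its larger term contributes \<open>ln 2 / n\<close> to the rate,
  which tends to 0.
\<close>

lemma growth_rate_subadditive:
  fixes a b c :: "nat \<Rightarrow> ereal"
  assumes "\<And>n. 0 \<le> a n" "\<And>n. 0 \<le> b n" "\<And>n. c n \<le> a n + b n"
  shows "limsup (\<lambda>n. ereal (1 / real n) * ext_ln (c n)) \<le>
    max (limsup (\<lambda>n. ereal (1 / real n) * ext_ln (a n)))
        (limsup (\<lambda>n. ereal (1 / real n) * ext_ln (b n)))"
proof -
  define A where "A n = ereal (1 / real n) * ext_ln (a n)" for n
  define B where "B n = ereal (1 / real n) * ext_ln (b n)" for n
  have "ereal (1 / real n) * ext_ln (c n) \<le> ereal (ln 2 / real n) + max (A n) (B n)"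
    if "n \<ge> 1" for n
  proof -
    let ?r = "ereal (1 / real n)"
    have r: "0 < ?r" "?r \<noteq> \<infinity>" using that by auto
    have "?r * ext_ln (c n) \<le> ?r * ext_ln (a n + b n)"
      using r by (intro ereal_mult_left_mono ext_ln_mono assms) auto
    also have "\<dots> \<le> ?r * (ereal (ln 2) + max (ext_ln (a n)) (ext_ln (b n)))"
      using r by (intro ereal_mult_left_mono ext_ln_add_le assms) auto
    also have "\<dots> = ereal (ln 2 / real n) + ?r * max (ext_ln (a n)) (ext_ln (b n))"
      using that by (cases "max (ext_ln (a n)) (ext_ln (b n))") (auto simp: field_simps)
    also have "?r * max (ext_ln (a n)) (ext_ln (b n)) = max (A n) (B n)"
      unfolding A_def B_def
      using r by (auto simp: max_def ereal_mult_le_mult_iff)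
    finally show ?thesis .
  qed
  then have "limsup (\<lambda>n. ereal (1 / real n) * ext_ln (c n))
      \<le> limsup (\<lambda>n. ereal (ln 2 / real n) + max (A n) (B n))"
    by (intro Limsup_mono) (auto simp: eventually_sequentially)
  also have "\<dots> = 0 + limsup (\<lambda>n. max (A n) (B n))"
  proof (rule ereal_limsup_lim_add)
    have "(\<lambda>n. ln 2 / real n) \<longlonglongrightarrow> 0" by (rule lim_const_over_n)
    then show "(\<lambda>n. ereal (ln 2 / real n)) \<longlonglongrightarrow> 0" by (simp add: zero_ereal_def)
  qed simp
  finally show ?thesis by (simp add: limsup_max_ereal A_def B_def)
qed

section \<open>Entropy of a union\<close>

lemma entropy_eps_antimono:
  assumes "\<epsilon> \<le> \<epsilon>'"
  shows "entropy_eps X D \<sigma> d \<epsilon>' K \<le> entropy_eps X D \<sigma> d \<epsilon> K"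
  unfolding entropy_eps_def
  by (intro Limsup_mono always_eventually allI ereal_mult_left_mono ext_ln_mono
      ssep_antimono_eps assms) auto

text \<open>
  By monotonicity in \<open>\<epsilon>\<close> the limit at 0 is a supremum, which makes comparing entropies a matter of
  comparing them for each single \<open>\<epsilon>\<close>.
\<close>

lemma entropy_on_eq_SUP:
  "entropy_on X D \<sigma> d K = (SUP \<epsilon>\<in>{0<..}. entropy_eps X D \<sigma> d \<epsilon> K)"
proof -
  let ?h = "\<lambda>\<epsilon>. entropy_eps X D \<sigma> d \<epsilon> K"
  let ?S = "SUP \<epsilon>\<in>{0<..}. ?h \<epsilon>"
  have "(?h \<longlongrightarrow> ?S) (at_right 0)"
  proof (rule increasing_tendsto)
    show "\<forall>\<^sub>F \<epsilon> in at_right 0. ?h \<epsilon> \<le> ?S"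
      using eventually_at_right_less by eventually_elim (auto intro: SUP_upper)
    fix x assume "x < ?S"
    then obtain \<delta> where \<delta>: "\<delta> > 0" "x < ?h \<delta>" by (auto simp: less_SUP_iff)
    have "\<forall>\<^sub>F \<epsilon> in at_right 0. \<epsilon> \<in> {0<..<\<delta>}"
      using \<delta>(1) by (rule eventually_at_right_real)
    then show "\<forall>\<^sub>F \<epsilon> in at_right 0. x < ?h \<epsilon>"
    proof eventually_elim
      case (elim \<epsilon>)
      then show ?case using \<delta>(2) entropy_eps_antimono[of \<epsilon> \<delta>] less_le_trans by fastforce
    qed
  qed
  then show ?thesis unfolding entropy_on_def by (intro tendsto_Lim) simp_all
qed

lemma entropy_on_Un_le:
  "entropy_on X D \<sigma> d (K \<union> L) \<le> max (entropy_on X D \<sigma> d K) (entropy_on X D \<sigma> d L)"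
  unfolding entropy_on_eq_SUP
proof (rule SUP_least)
  fix \<epsilon> :: real assume "\<epsilon> \<in> {0<..}"
  have "entropy_eps X D \<sigma> d \<epsilon> (K \<union> L) \<le> max (entropy_eps X D \<sigma> d \<epsilon> K) (entropy_eps X D \<sigma> d \<epsilon> L)"
    unfolding entropy_eps_def by (intro growth_rate_subadditive ssep_nonneg ssep_Un_le)
  also have "\<dots> \<le> max (SUP \<epsilon>\<in>{0<..}. entropy_eps X D \<sigma> d \<epsilon> K) (SUP \<epsilon>\<in>{0<..}. entropy_eps X D \<sigma> d \<epsilon> L)"
    using \<open>\<epsilon> \<in> {0<..}\<close> by (intro max.mono SUP_upper)
  finally show "entropy_eps X D \<sigma> d \<epsilon> (K \<union> L) \<le> \<dots>" .
qed

section \<open>Restriction to a closed forward invariant set\<close>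

text \<open>
  The restricted system requires every intermediate iterate to lie in \<open>Y\<close>; forward invariance makes
  this automatic for orbits that start in \<open>Y\<close>.
\<close>

lemma iter_dom_subtopology:
  assumes "\<sigma> ` (D \<inter> Y) \<subseteq> Y"
  shows "iter_dom (subtopology X Y) (D \<inter> Y) \<sigma> n = iter_dom X D \<sigma> n \<inter> Y"
proof (induction n)
  case (Suc n)
  have "(\<sigma> ^^ m) x \<in> Y" if "x \<in> iter_dom X D \<sigma> m \<inter> Y" for x m
    using that
  proof (induction m)
    case (Suc m)
    then show ?case using assms by auto
  qed simp
  with Suc show ?case by auto
qed simp

text \<open>
  Every closed \<open>F\<close> that competes in \<open>X\<close> can be replaced by \<open>F \<inter> Y\<close>, which is closed as \<open>Y\<close> is and has
  the same intersection with \<open>K\<close>.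
\<close>

lemma ssep_subtopology:
  assumes "closedin X Y" "\<sigma> ` (D \<inter> Y) \<subseteq> Y" "K \<subseteq> Y"
  shows "ssep (subtopology X Y) (D \<inter> Y) \<sigma> d n \<epsilon> K = ssep X D \<sigma> d n \<epsilon> K"
proof -
  let ?s = "\<lambda>F. sep X D \<sigma> d n \<epsilon> (K \<inter> F)"
  have dist: "iter_dist (subtopology X Y) (D \<inter> Y) \<sigma> d n x y = iter_dist X D \<sigma> d n x y"
    if "x \<in> Y" "y \<in> Y" for x y
  proof -
    have "iter_idx (subtopology X Y) (D \<inter> Y) \<sigma> n z = iter_idx X D \<sigma> n z" if "z \<in> Y" for z
      using that by (auto simp: iter_idx_def iter_dom_subtopology[OF assms(2)])
    with that show ?thesis by (simp add: iter_dist_def)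
  qed
  have "separated_set (subtopology X Y) (D \<inter> Y) \<sigma> d n \<epsilon> (K \<inter> F) A
      \<longleftrightarrow> separated_set X D \<sigma> d n \<epsilon> (K \<inter> F) A" for F A
    unfolding separated_set_def
  proof (intro conj_cong refl ball_cong imp_cong)
    fix x y assume "A \<subseteq> K \<inter> F" "x \<in> A" "y \<in> A"
    then have "x \<in> Y" "y \<in> Y" using assms(3) by auto
    then show "(\<epsilon> < iter_dist (subtopology X Y) (D \<inter> Y) \<sigma> d n x y) = (\<epsilon> < iter_dist X D \<sigma> d n x y)"
      by (simp add: dist)
  qed
  then have sep: "sep (subtopology X Y) (D \<inter> Y) \<sigma> d n \<epsilon> (K \<inter> F) = ?s F" for F
    by (simp add: sep_def)
  have closed: "{F. closedin (subtopology X Y) F \<and> F \<subseteq> iter_dom (subtopology X Y) (D \<inter> Y) \<sigma> (n - 1)}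
      = {F. closedin X F \<and> F \<subseteq> iter_dom X D \<sigma> (n - 1) \<and> F \<subseteq> Y}"
    using assms(1) by (auto simp: closedin_closed_subtopology iter_dom_subtopology[OF assms(2)])
  show ?thesis
  proof (rule antisym)
    show "ssep (subtopology X Y) (D \<inter> Y) \<sigma> d n \<epsilon> K \<le> ssep X D \<sigma> d n \<epsilon> K"
      unfolding ssep_def closed sep by (rule SUP_subset_mono) auto
    have "?s F \<le> ssep (subtopology X Y) (D \<inter> Y) \<sigma> d n \<epsilon> K"
      if F: "closedin X F" "F \<subseteq> iter_dom X D \<sigma> (n - 1)" for F
    proof -
      have "?s F = ?s (F \<inter> Y)" using assms(3) by (metis inf.absorb_iff1 inf.assoc inf.commute)
      also have "\<dots> \<le> ssep (subtopology X Y) (D \<inter> Y) \<sigma> d n \<epsilon> K"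
        unfolding ssep_def closed sep by (rule SUP_upper) (use F assms(1) in auto)
      finally show ?thesis .
    qed
    then show "ssep X D \<sigma> d n \<epsilon> K \<le> ssep (subtopology X Y) (D \<inter> Y) \<sigma> d n \<epsilon> K"
      unfolding ssep_def[of X] by (auto intro!: SUP_least)
  qed
qed

lemma restricted_entropy_eq_SUP:
  assumes "closedin X Y" "\<sigma> ` (D \<inter> Y) \<subseteq> Y"
  shows "restricted_entropy X D \<sigma> d Y =
    (SUP K\<in>{K. compactin X K \<and> K \<subseteq> Y}. entropy_on X D \<sigma> d K)"
proof -
  have "entropy_on (subtopology X Y) (D \<inter> Y) \<sigma> d K = entropy_on X D \<sigma> d K" if "K \<subseteq> Y" for K
    by (simp add: entropy_on_def entropy_eps_def ssep_subtopology[OF assms that])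
  then show ?thesis
    by (auto simp: restricted_entropy_def DR_entropy_def compactin_subtopology intro!: SUP_cong)
qed

lemma DR_entropy_closed_cover:
  assumes Y: "closedin X Y" "\<sigma> ` (D \<inter> Y) \<subseteq> Y"
    and Z: "closedin X Z" "\<sigma> ` (D \<inter> Z) \<subseteq> Z"
    and cover: "topspace X \<subseteq> Y \<union> Z"
  shows "DR_entropy X D \<sigma> d = max (restricted_entropy X D \<sigma> d Y) (restricted_entropy X D \<sigma> d Z)"
    (is "_ = ?max")
proof (rule antisym)
  show "DR_entropy X D \<sigma> d \<le> ?max"
    unfolding DR_entropy_def
  proof (rule SUP_least)
    fix K assume "K \<in> {K. compactin X K}"
    then have K: "compactin X K" by simp
    have part: "entropy_on X D \<sigma> d (K \<inter> V) \<le> restricted_entropy X D \<sigma> d V"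
      if V: "closedin X V" "\<sigma> ` (D \<inter> V) \<subseteq> V" for V
      unfolding restricted_entropy_eq_SUP[OF V]
      by (rule SUP_upper) (use K V(1) in \<open>auto intro: compact_Int_closedin\<close>)
    have "K = (K \<inter> Y) \<union> (K \<inter> Z)"
      using compactin_subset_topspace[OF K] cover by blast
    then have "entropy_on X D \<sigma> d K
        \<le> max (entropy_on X D \<sigma> d (K \<inter> Y)) (entropy_on X D \<sigma> d (K \<inter> Z))"
      using entropy_on_Un_le by metis
    also have "\<dots> \<le> ?max" by (intro max.mono part Y Z)
    finally show "entropy_on X D \<sigma> d K \<le> ?max" .
  qed
  show "?max \<le> DR_entropy X D \<sigma> d"
    unfolding restricted_entropy_eq_SUP[OF Y] restricted_entropy_eq_SUP[OF Z] DR_entropy_def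
    by (intro max.boundedI SUP_subset_mono) auto
qed

theorem theorem4p3:
  fixes X :: "'a topology" and D :: "'a set" and \<sigma> :: "'a \<Rightarrow> 'a" and d :: "'a \<Rightarrow> 'a \<Rightarrow> real"
  assumes "Metric_space (topspace X) d"
    and "X = Metric_space.mtopology (topspace X) d"
    and "DR_system X D \<sigma>"
  shows "DR_entropy X D \<sigma> d =
    max (restricted_entropy X D \<sigma> d (nonwandering_set X D \<sigma>))
        (restricted_entropy X D \<sigma> d (X closure_of (wandering_set X D \<sigma>)))"
proof -
  interpret Deaconu_Renault X D \<sigma> using assms(3) by unfold_locales
  have "wandering_set X D \<sigma> \<subseteq> X closure_of wandering_set X D \<sigma>"
    by (intro closure_of_subset openin_subset openin_wandering_set)
  then show ?thesis
    by (intro DR_entropy_closed_cover closedin_nonwandering_set nonwandering_set_forward_invariant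
        closedin_closure_of closure_wandering_set_forward_invariant)
       (auto simp: nonwandering_set_eq)
qed

end
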